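(* Let $G$ be a finite group, and let $A$ be a multiset of cardinality $|G|$ whose elements belong to $G$. Then $A$ is quotient-realizable in $G$ if and only if $A$ admits a cycle-tiling decomposition.
   Context: All multisets are counted with multiplicity; groups are written multiplicatively with identity $1$. Quotient-realizable: a multiset $A$ of cardinality $|G|$ with elements in a finite group $G$ is quotient-realizable in $G$ if there exist bijections $b,c:\{1,\ldots,|G|\}\to G$ such that $A=\{b(i)c(i)^{-1}:1\le i\le |G|\}$ as multisets. Simple product-one word: for a word $w=(g_1,\ldots,g_\ell)$ in $G$ (with $\ell\ge 1$), define its left partial products by $p_0=1$ and $p_j=g_jg_{j-1}\cdots g_1$ for $1\le j\le \ell$. The word $w$ is a simple product-one word if $p_\ell=1$ and $p_0,p_1,\ldots,p_{\ell-1}$ are pairwise distinct. In this case put $P(w)=\{p_0,p_1,\ldots,p_{\ell-1}\}$. For any word $w=(g_1,\ldots,g_\ell)$, $[w]$ denotes the multiset of its letters $g_1,\ldots,g_\ell$, counted with multiplicity. Cycle-tiling decomposition: a cycle-tiling decomposition of $A$ is a finite collection of simple product-one words $w_1,\ldots,w_r$ in $G$ such that $A=[w_1]\sqcup\cdots\sqcup[w_r]$ as multisets (multiset sum, i.e. multiplicities add), and such that there exist elements $x_1,\ldots,x_r\in G$ with $G=\bigsqcup_{j=1}^r P(w_j)x_j$ (disjoint union of sets), where $P(w_j)x_j=\{px_j:p\in P(w_j)\}$. *)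

theory Defs
  imports "HOL-Algebra.Coset" "HOL-Library.Multiset" "HOL-Library.Disjoint_Sets"
begin

definition quotient_realizable :: "('a, 'm) monoid_scheme \<Rightarrow> 'a multiset \<Rightarrow> bool" where
  "quotient_realizable G A \<longleftrightarrow>
     size A = order G \<and> set_mset A \<subseteq> carrier G \<and>
     (\<exists>b c. bij_betw b {1..order G} (carrier G) \<and> bij_betw c {1..order G} (carrier G) \<and>
        A = {# b i \<otimes>\<^bsub>G\<^esub> inv\<^bsub>G\<^esub> (c i). i \<in># mset_set {1..order G} #})"

text \<open>
  Words are lists, indexed from 0: the letter \<open>g\<^sub>j\<close> of the word \<open>w\<close> is \<open>w ! (j - 1)\<close>, so that
  \<open>left_partial_prod G w j\<close> is \<open>g\<^sub>j \<cdots> g\<^sub>1\<close> (new letters are multiplied on the left).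
  It is only meaningful for \<open>j \<le> length w\<close>.
\<close>

primrec left_partial_prod :: "('a, 'm) monoid_scheme \<Rightarrow> 'a list \<Rightarrow> nat \<Rightarrow> 'a" where
  "left_partial_prod G w 0 = \<one>\<^bsub>G\<^esub>"
| "left_partial_prod G w (Suc j) = w ! j \<otimes>\<^bsub>G\<^esub> left_partial_prod G w j"

definition simple_product_one_word :: "('a, 'm) monoid_scheme \<Rightarrow> 'a list \<Rightarrow> bool" where
  "simple_product_one_word G w \<longleftrightarrow>
     set w \<subseteq> carrier G \<and> 1 \<le> length w \<and>
     left_partial_prod G w (length w) = \<one>\<^bsub>G\<^esub> \<and>
     inj_on (left_partial_prod G w) {0..<length w}"

definition partial_prod_set :: "('a, 'm) monoid_scheme \<Rightarrow> 'a list \<Rightarrow> 'a set" where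
  "partial_prod_set G w = left_partial_prod G w ` {0..<length w}"

text \<open>
  The collection \<open>w\<^sub>1, \<dots>, w\<^sub>r\<close> is a list of words, so the same word may occur several times.
  The translates \<open>P(w\<^sub>j) x\<^sub>j\<close> must be disjoint as an indexed family.
\<close>

definition cycle_tiling_decomposition ::
    "('a, 'm) monoid_scheme \<Rightarrow> 'a multiset \<Rightarrow> 'a list list \<Rightarrow> bool" where
  "cycle_tiling_decomposition G A ws \<longleftrightarrow>
     (\<forall>w \<in> set ws. simple_product_one_word G w) \<and>
     A = (\<Sum>j<length ws. mset (ws ! j)) \<and>
     (\<exists>x. (\<forall>j<length ws. x j \<in> carrier G) \<and>
        disjoint_family_on (\<lambda>j. partial_prod_set G (ws ! j) #>\<^bsub>G\<^esub> x j) {..<length ws} \<and>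
        carrier G = (\<Union>j<length ws. partial_prod_set G (ws ! j) #>\<^bsub>G\<^esub> x j))"

end

theory Submission
  imports Defs
begin

text \<open>
  A quotient realization of \<open>A\<close> is the same as a permutation \<open>f\<close> of \<open>G\<close> with \<open>A\<close> the multiset
  of the quotients \<open>f(g) g\<inverse>\<close>. Along a cycle \<open>x, f(x), f\<^sup>2(x), \<dots>\<close> these quotients form
  a word whose left partial products are \<open>f\<^sup>j(x) x\<inverse>\<close>, so the word is a simple product-one word,
  \<open>P(w) x\<close> is the cycle, and the cycles of \<open>f\<close> tile \<open>G\<close>. Conversely, cyclically shifting each
  tile \<open>P(w\<^sub>j) x\<^sub>j\<close> gives a permutation of \<open>G\<close> whose quotients are the letters of the words.
\<close>

section \<open>Multisets, cycles of injections, and realizations as permutations\<close>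

lemma image_mset_mset_set_eq_sum:
  assumes "finite I"
  shows "image_mset f (mset_set I) = (\<Sum>i\<in>I. {#f i#})"
  using assms by (induction I) auto

lemma mset_eq_sum_nth: "mset w = (\<Sum>i<length w. {#w ! i#})"
proof -
  have "mset w = mset (map (\<lambda>i. w ! i) [0..<length w])" by (simp add: map_nth)
  also have "\<dots> = image_mset (\<lambda>i. w ! i) (mset_set {..<length w})"
    by (simp add: atLeast0LessThan)
  finally show ?thesis by (simp add: image_mset_mset_set_eq_sum)
qed

text \<open>By finiteness the orbit of \<open>x\<close> repeats a value. Injectivity cancels the
  common initial iterations, so the orbit returns to \<open>x\<close> itself instead of entering a
  loop after a tail. The least positive return time then makes the earlier iterates
  distinct.\<close>

lemma funpow_cycle:
  assumes "finite S" "inj_on f S" "f ` S \<subseteq> S" "x \<in> S"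
  obtains n where "n > 0" "(f ^^ n) x = x" "inj_on (\<lambda>j. (f ^^ j) x) {..<n}"
    "\<And>j. (f ^^ j) x \<in> S"
proof -
  have closed: "(f ^^ j) y \<in> S" if "y \<in> S" for j y
    using that assms(3) by (induction j) auto
  have cancel: "y = z" if "y \<in> S" "z \<in> S" "(f ^^ i) y = (f ^^ i) z" for y z i
    using that(3)
  proof (induction i)
    case (Suc i)
    then show ?case using closed that(1,2) assms(2) by (auto dest: inj_onD)
  qed simp
  have return: "(f ^^ (j - i)) x = x" if "i < j" "(f ^^ i) x = (f ^^ j) x" for i j
  proof (rule cancel[of _ _ i])
    have "(f ^^ i) ((f ^^ (j - i)) x) = (f ^^ (i + (j - i))) x"
      by (simp only: funpow_add o_apply)
    then show "(f ^^ i) ((f ^^ (j - i)) x) = (f ^^ i) x" using that by simp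
  qed (use closed assms(4) in auto)
  have "\<not> inj (\<lambda>j. (f ^^ j) x)"
  proof
    assume "inj (\<lambda>j. (f ^^ j) x)"
    moreover have "finite (range (\<lambda>j. (f ^^ j) x))"
      using closed assms(1,4) by (auto intro: finite_subset)
    ultimately show False using finite_imageD by fastforce
  qed
  then obtain i j where "i < j" "(f ^^ i) x = (f ^^ j) x"
    by (metis injI linorder_neqE_nat)
  then have ex: "\<exists>n. 0 < n \<and> (f ^^ n) x = x"
    using return by (metis zero_less_diff)
  define n where "n = (LEAST n. 0 < n \<and> (f ^^ n) x = x)"
  have n: "0 < n" "(f ^^ n) x = x"
    using LeastI_ex[OF ex] by (auto simp: n_def)
  have least: "n \<le> m" if "0 < m" "(f ^^ m) x = x" for m
    using that by (auto simp: n_def intro: Least_le)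
  have "i = j" if "i < n" "j < n" "(f ^^ i) x = (f ^^ j) x" for i j
  proof (rule ccontr)
    assume "i \<noteq> j"
    then consider "i < j" | "j < i" by linarith
    then show False
    proof cases
      case 1
      then show False using return[OF 1 that(3)] least[of "j - i"] that(2) by simp
    next
      case 2
      then show False using return[OF 2 that(3)[symmetric]] least[of "i - j"] that(1) by simp
    qed
  qed
  then have "inj_on (\<lambda>j. (f ^^ j) x) {..<n}" by (auto intro: inj_onI)
  with n closed assms(4) that show thesis by blast
qed

text \<open>The enumerations are eliminated by substituting \<open>g = c i\<close>: the permutation
  is \<open>b\<close> composed with the inverse of \<open>c\<close>. Conversely, any enumeration
  \<open>c\<close> of the group serves, with \<open>f \<circ> c\<close> in the role of
  \<open>b\<close>.\<close>

lemma quotient_realizable_iff_perm: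
  fixes G (structure)
  assumes "finite (carrier G)" "size A = order G" "set_mset A \<subseteq> carrier G"
  shows "quotient_realizable G A \<longleftrightarrow>
    (\<exists>f. bij_betw f (carrier G) (carrier G) \<and>
      A = image_mset (\<lambda>g. f g \<otimes> inv g) (mset_set (carrier G)))" (is "_ \<longleftrightarrow> ?R")
proof
  assume "quotient_realizable G A"
  then obtain b c where b: "bij_betw b {1..order G} (carrier G)"
    and c: "bij_betw c {1..order G} (carrier G)"
    and A: "A = {# b i \<otimes> inv (c i). i \<in># mset_set {1..order G} #}"
    by (auto simp: quotient_realizable_def)
  define f where "f = b \<circ> inv_into {1..order G} c"
  have fc: "f (c i) = b i" if "i \<in> {1..order G}" for i
    using that c by (simp add: f_def bij_betw_inv_into_left)
  have "mset_set (carrier G) = image_mset c (mset_set {1..order G})"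
    using c by (simp add: bij_betw_def image_mset_mset_set)
  then have "A = image_mset (\<lambda>g. f g \<otimes> inv g) (mset_set (carrier G))"
    unfolding A using fc by (auto simp: multiset.map_comp intro!: image_mset_cong)
  moreover have "bij_betw f (carrier G) (carrier G)"
    unfolding f_def using b c by (blast intro: bij_betw_trans bij_betw_inv_into)
  ultimately show ?R by blast
next
  assume ?R
  then obtain f where f: "bij_betw f (carrier G) (carrier G)"
    and A: "A = image_mset (\<lambda>g. f g \<otimes> inv g) (mset_set (carrier G))" by blast
  obtain c where c: "bij_betw c {1..order G} (carrier G)"
    using ex_bij_betw_nat_finite_1[OF assms(1)] by (auto simp: order_def)
  have "mset_set (carrier G) = image_mset c (mset_set {1..order G})"
    using c by (simp add: bij_betw_def image_mset_mset_set)
  then have "A = {# (f \<circ> c) i \<otimes> inv (c i). i \<in># mset_set {1..order G} #}"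
    by (simp add: A multiset.map_comp comp_def)
  then show "quotient_realizable G A"
    using assms(2,3) c bij_betw_trans[OF c f] unfolding quotient_realizable_def by blast
qed

section \<open>Words and tilings in a group\<close>

context group
begin

lemma left_partial_prod_closed:
  assumes "set w \<subseteq> carrier G" "j \<le> length w"
  shows "left_partial_prod G w j \<in> carrier G"
  using assms(2)
proof (induction j)
  case (Suc j)
  then have "w ! j \<in> carrier G" using assms(1) nth_mem by force
  then show ?case using Suc by simp
qed simp

text \<open>Moving the index window up by one drops the value at index 0 and gains the one at
  \<open>length w\<close>. Both are the identity, because the whole word has product one.\<close>

lemma partial_prod_set_shift:
  assumes "simple_product_one_word G w"
  shows "(\<lambda>i. left_partial_prod G w (Suc i)) ` {..<length w} = partial_prod_set G w"
proof -
  obtain n where n: "length w = Suc n"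
    using assms by (cases "length w") (auto simp: simple_product_one_word_def)
  have "(\<lambda>i. left_partial_prod G w (Suc i)) ` {..<length w} =
      left_partial_prod G w ` (Suc ` {..<Suc n})"
    by (simp add: image_image n)
  also have "Suc ` {..<Suc n} = insert (length w) (Suc ` {..<n})"
    by (auto simp: n lessThan_Suc)
  also have "left_partial_prod G w ` \<dots> = left_partial_prod G w ` (insert 0 (Suc ` {..<n}))"
    using assms by (simp add: simple_product_one_word_def)
  also have "insert 0 (Suc ` {..<n}) = {0..<length w}"
    by (auto simp: n lessThan_Suc_eq_insert_0 atLeast0LessThan)
  finally show ?thesis by (simp add: partial_prod_set_def)
qed

lemma cycle_word:
  assumes "f ` carrier G \<subseteq> carrier G" "x \<in> carrier G" "n > 0" "(f ^^ n) x = x"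
    and "inj_on (\<lambda>j. (f ^^ j) x) {..<n}"
  defines "C \<equiv> (\<lambda>j. (f ^^ j) x) ` {..<n}"
  obtains w where "simple_product_one_word G w" "partial_prod_set G w #> x = C"
    "mset w = image_mset (\<lambda>g. f g \<otimes> inv g) (mset_set C)"
proof -
  let ?y = "\<lambda>j. (f ^^ j) x"
  define w where "w = map (\<lambda>j. ?y (Suc j) \<otimes> inv (?y j)) [0..<n]"
  have y: "?y j \<in> carrier G" for j
    using assms(1,2) by (induction j) auto
  have len: "length w = n" by (simp add: w_def)
  have set_w: "set w \<subseteq> carrier G" using y[of "Suc _"] y by (auto simp: w_def simp del: funpow.simps)
  \<comment> \<open>The product telescopes. The endpoint \<open>j = n\<close> is included because
    there \<open>(f ^^ n) x = x\<close> shows that the whole word has product one.\<close>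
  have p: "left_partial_prod G w j = ?y j \<otimes> inv x" if "j \<le> n" for j
    using that
  proof (induction j)
    case 0
    then show ?case using assms(2) by simp
  next
    case (Suc j)
    have "left_partial_prod G w (Suc j) = (?y (Suc j) \<otimes> inv ?y j) \<otimes> (?y j \<otimes> inv x)"
      using Suc by (simp add: w_def)
    also have "\<dots> = ?y (Suc j) \<otimes> inv x"
      using y[of j] y[of "Suc j"] assms(2)
      by (metis inv_closed l_inv l_one m_assoc m_closed)
    finally show ?case .
  qed
  have "inj_on (left_partial_prod G w) {0..<length w}"
  proof (rule inj_onI)
    fix i j assume ij: "i \<in> {0..<length w}" "j \<in> {0..<length w}"
      "left_partial_prod G w i = left_partial_prod G w j"
    then have "?y i = ?y j" using y assms(2) by (simp add: p len)
    with ij assms(5) show "i = j" by (auto simp: len dest: inj_onD)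
  qed
  then have simple: "simple_product_one_word G w"
    using set_w p[of n] assms(2,3,4) by (simp add: simple_product_one_word_def len)
  have "partial_prod_set G w #> x = (\<lambda>j. ?y j \<otimes> inv x \<otimes> x) ` {..<n}"
    by (auto simp: partial_prod_set_def r_coset_def len p)
  also have "\<dots> = C"
    unfolding C_def using y assms(2) by (intro image_cong) (simp_all add: m_assoc)
  finally have tile: "partial_prod_set G w #> x = C" .
  \<comment> \<open>As the iterates below \<open>n\<close> are distinct, positions in
    \<open>w\<close> correspond one to one to points of \<open>C\<close>, so multiplicities
    agree.\<close>
  have "mset_set C = image_mset ?y (mset_set {..<n})"
    unfolding C_def using assms(5) by (simp add: image_mset_mset_set)
  then have "mset w = image_mset (\<lambda>g. f g \<otimes> inv g) (mset_set C)"
    by (simp add: w_def multiset.map_comp comp_def atLeast0LessThan)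
  with simple tile that show thesis by blast
qed

text \<open>Induction on \<open>S\<close> splits off one cycle at a time. What is left is no longer
  a group, so the claim is made for any finite subset that \<open>f\<close> permutes, while
  \<open>f\<close> remains a self-map of the whole carrier as \<open>cycle_word\<close>
  requires.\<close>

lemma cycles_tile:
  assumes "finite S" "S \<subseteq> carrier G" "f ` carrier G \<subseteq> carrier G" "inj_on f S" "f ` S = S"
  shows "\<exists>ws x. (\<forall>w \<in> set ws. simple_product_one_word G w) \<and>
    image_mset (\<lambda>g. f g \<otimes> inv g) (mset_set S) = (\<Sum>j<length ws. mset (ws ! j)) \<and>
    (\<forall>j<length ws. x j \<in> carrier G) \<and>
    disjoint_family_on (\<lambda>j. partial_prod_set G (ws ! j) #> x j) {..<length ws} \<and>
    S = (\<Union>j<length ws. partial_prod_set G (ws ! j) #> x j)"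
  using assms(1,2,4,5)
proof (induction S rule: finite_psubset_induct)
  case (psubset S)
  show ?case
  proof (cases "S = {}")
    case True
    then show ?thesis by (intro exI[of _ "[]"]) (simp add: disjoint_family_on_def)
  next
    case False
    then obtain y where y: "y \<in> S" by blast
    obtain n where n: "n > 0" "(f ^^ n) y = y" "inj_on (\<lambda>j. (f ^^ j) y) {..<n}"
      "\<And>j. (f ^^ j) y \<in> S"
      using funpow_cycle[OF psubset.hyps psubset.prems(2) _ y] psubset.prems(3) by blast
    define C where "C = (\<lambda>j. (f ^^ j) y) ` {..<n}"
    have yG: "y \<in> carrier G" using y psubset.prems(1) by blast
    obtain w where w: "simple_product_one_word G w" "partial_prod_set G w #> y = C"
      "mset w = image_mset (\<lambda>g. f g \<otimes> inv g) (mset_set C)"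
      using cycle_word[OF assms(3) yG n(1,2,3)] unfolding C_def by blast
    have CS: "C \<subseteq> S" and yC: "y \<in> C" using n by (auto simp: C_def intro: image_eqI[of _ _ 0])
    \<comment> \<open>Only the last point of the cycle needs care: it is sent back to
      \<open>y\<close> because \<open>n\<close> is a period.\<close>
    have "f ` C \<subseteq> C"
    proof
      fix z assume "z \<in> f ` C"
      then obtain j where j: "j < n" "z = (f ^^ Suc j) y" by (auto simp: C_def)
      then show "z \<in> C"
      proof (cases "Suc j = n")
        case True
        then show ?thesis using j n(2) yC by simp
      next
        case False
        then show ?thesis using j unfolding C_def by (intro image_eqI[of _ _ "Suc j"]) auto
      qed
    qed
    moreover have "finite C" by (simp add: C_def)
    \<comment> \<open>An injective self-map of a finite set is onto. Hence \<open>f\<close> also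
      permutes the complement \<open>S - C\<close>, to which the induction hypothesis
      applies.\<close>
    ultimately have "f ` C = C"
      using endo_inj_surj psubset.prems(2) CS inj_on_subset by metis
    then have "f ` (S - C) = S - C"
      using inj_on_image_set_diff[OF psubset.prems(2), of S C] CS psubset.prems(3) by simp
    moreover have "S - C \<subset> S" using y yC by blast
    moreover have "S - C \<subseteq> carrier G" "inj_on f (S - C)"
      using psubset.prems(1,2) by (auto intro: inj_on_subset)
    ultimately obtain ws x where IH: "\<forall>w \<in> set ws. simple_product_one_word G w"
      "image_mset (\<lambda>g. f g \<otimes> inv g) (mset_set (S - C)) = (\<Sum>j<length ws. mset (ws ! j))"
      "\<forall>j<length ws. x j \<in> carrier G"
      "disjoint_family_on (\<lambda>j. partial_prod_set G (ws ! j) #> x j) {..<length ws}"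
      "S - C = (\<Union>j<length ws. partial_prod_set G (ws ! j) #> x j)"
      using psubset.IH[of "S - C"] by blast
    \<comment> \<open>Appending at the end leaves the old indices and their tiles unchanged; the new
      cycle gets index \<open>length ws\<close> and translating element \<open>y\<close>.\<close>
    let ?ws = "ws @ [w]" and ?x = "x(length ws := y)"
    let ?T = "\<lambda>ws x j. partial_prod_set G (ws ! j) #> x j"
    have T_old: "?T ?ws ?x j = ?T ws x j" if "j < length ws" for j
      using that by (simp add: nth_append)
    have T_new: "?T ?ws ?x (length ws) = C" using w(2) by simp
    have Un_old: "(\<Union>j<length ws. ?T ?ws ?x j) = S - C"
      unfolding IH(5) using T_old by (intro SUP_cong) auto
    have "disjoint_family_on (?T ?ws ?x) {..<length ws}"
      using IH(4) T_old by (auto simp: disjoint_family_on_def)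
    then have disj: "disjoint_family_on (?T ?ws ?x) {..<length ?ws}"
      using T_new Un_old by (simp add: lessThan_Suc disjoint_family_on_insert)
    have Un: "S = (\<Union>j<length ?ws. ?T ?ws ?x j)"
      using T_new Un_old CS by (simp add: lessThan_Suc) blast
    have "mset_set S = mset_set (S - C) + mset_set C"
      using mset_set_Union[of "S - C" C] psubset.hyps CS \<open>finite C\<close>
      by (simp add: Un_absorb2 Diff_Int_distrib2)
    then have "image_mset (\<lambda>g. f g \<otimes> inv g) (mset_set S) = (\<Sum>j<length ?ws. mset (?ws ! j))"
      using IH(2) w(3) by (simp add: lessThan_Suc nth_append)
    moreover have "\<forall>j<length ?ws. ?x j \<in> carrier G" using IH(3) yG by (simp add: less_Suc_eq)
    moreover have "\<forall>v \<in> set ?ws. simple_product_one_word G v" using IH(1) w(1) by auto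
    ultimately show ?thesis using disj Un by blast
  qed
qed

text \<open>Right translation is injective and the tiles partition the group, so pairs (word,
  position) enumerate it. The enumeration \<open>p j\<close> of each set of partial products is left
  free because two are needed later: by index \<open>i\<close> and by index
  \<open>Suc i\<close>.\<close>

lemma bij_betw_tiling:
  assumes "finite (carrier G)"
    and "\<forall>w \<in> set ws. simple_product_one_word G w"
    and "\<forall>j<length ws. x j \<in> carrier G"
    and "disjoint_family_on (\<lambda>j. partial_prod_set G (ws ! j) #> x j) {..<length ws}"
    and "carrier G = (\<Union>j<length ws. partial_prod_set G (ws ! j) #> x j)"
    and "\<And>j. j < length ws \<Longrightarrow> bij_betw (p j) {..<length (ws ! j)} (partial_prod_set G (ws ! j))"
  shows "bij_betw (\<lambda>(j, i). p j i \<otimes> x j) (SIGMA j:{..<length ws}. {..<length (ws ! j)}) (carrier G)"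
proof -
  let ?T = "\<lambda>j. partial_prod_set G (ws ! j) #> x j"
  have P: "partial_prod_set G (ws ! j) \<subseteq> carrier G" if "j < length ws" for j
  proof -
    have "simple_product_one_word G (ws ! j)" using assms(2) that by simp
    then show ?thesis
      by (auto simp: partial_prod_set_def simple_product_one_word_def intro!: left_partial_prod_closed)
  qed
  have T: "bij_betw (\<lambda>i. p j i \<otimes> x j) {..<length (ws ! j)} (?T j)" if j: "j < length ws" for j
  proof -
    have "bij_betw (\<lambda>g. g \<otimes> x j) (partial_prod_set G (ws ! j)) (?T j)"
      using P[OF j] assms(3) j
      by (auto simp: bij_betw_def r_coset_def inj_on_def subset_iff)
    from bij_betw_trans[OF assms(6)[OF j] this] show ?thesis by (simp add: comp_def)
  qed
  have img: "p j i \<otimes> x j \<in> ?T j" if "j < length ws" "i < length (ws ! j)" for j i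
    using T[OF that(1)] that(2) by (auto simp: bij_betw_def)
  show ?thesis
    unfolding bij_betw_def
  proof
    show "inj_on (\<lambda>(j, i). p j i \<otimes> x j) (SIGMA j:{..<length ws}. {..<length (ws ! j)})"
    proof (rule inj_onI, clarsimp)
      fix j i j' i'
      assume a: "j < length ws" "i < length (ws ! j)" "j' < length ws" "i' < length (ws ! j')"
        "p j i \<otimes> x j = p j' i' \<otimes> x j'"
      have "j = j'"
      proof (rule ccontr)
        assume "j \<noteq> j'"
        then have "?T j \<inter> ?T j' = {}" using assms(4) a(1,3) by (auto simp: disjoint_family_on_def)
        then show False using img[OF a(1,2)] img[OF a(3,4)] a(5) by auto
      qed
      moreover have "i = i'"
        using bij_betw_imp_inj_on[OF T[OF a(1)]] a \<open>j = j'\<close> by (auto dest: inj_onD)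
      ultimately show "j = j' \<and> i = i'" by simp
    qed
    have "(\<lambda>(j, i). p j i \<otimes> x j) ` (SIGMA j:{..<length ws}. {..<length (ws ! j)}) =
        (\<Union>j<length ws. (\<lambda>i. p j i \<otimes> x j) ` {..<length (ws ! j)})"
      by force
    also have "\<dots> = carrier G"
      unfolding assms(5) using T by (intro SUP_cong) (auto simp: bij_betw_def)
    finally show "(\<lambda>(j, i). p j i \<otimes> x j) ` (SIGMA j:{..<length ws}. {..<length (ws ! j)}) = carrier G" .
  qed
qed

lemma cycle_tiling_imp_perm:
  assumes fin: "finite (carrier G)" and "cycle_tiling_decomposition G A ws"
  obtains f where "bij_betw f (carrier G) (carrier G)"
    "A = image_mset (\<lambda>g. f g \<otimes> inv g) (mset_set (carrier G))"
proof -
  obtain x where simple: "\<forall>w \<in> set ws. simple_product_one_word G w"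
    and A: "A = (\<Sum>j<length ws. mset (ws ! j))"
    and x: "\<forall>j<length ws. x j \<in> carrier G"
    and disj: "disjoint_family_on (\<lambda>j. partial_prod_set G (ws ! j) #> x j) {..<length ws}"
    and Un: "carrier G = (\<Union>j<length ws. partial_prod_set G (ws ! j) #> x j)"
    using assms(2) unfolding cycle_tiling_decomposition_def by blast
  let ?I = "SIGMA j:{..<length ws}. {..<length (ws ! j)}"
  \<comment> \<open>\<open>c\<close> gives the point at position \<open>i\<close> of tile
    \<open>j\<close>, and \<open>b\<close> the next point of that tile, wrapping around after the
    last position.\<close>
  define c where "c = (\<lambda>(j, i). left_partial_prod G (ws ! j) i \<otimes> x j)"
  define b where "b = (\<lambda>(j, i). left_partial_prod G (ws ! j) (Suc i) \<otimes> x j)"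
  have sj: "simple_product_one_word G (ws ! j)" if "j < length ws" for j
    using simple that by simp
  have c: "bij_betw c ?I (carrier G)"
    unfolding c_def
    by (rule bij_betw_tiling[OF fin simple x disj Un])
      (use sj in \<open>auto simp: bij_betw_def partial_prod_set_def simple_product_one_word_def atLeast0LessThan\<close>)
  have b: "bij_betw b ?I (carrier G)"
    unfolding b_def
  proof (rule bij_betw_tiling[OF fin simple x disj Un])
    fix j assume j: "j < length ws"
    have img: "(\<lambda>i. left_partial_prod G (ws ! j) (Suc i)) ` {..<length (ws ! j)} =
        partial_prod_set G (ws ! j)"
      by (rule partial_prod_set_shift[OF sj[OF j]])
    \<comment> \<open>Injectivity of the shifted enumeration follows by counting: its image has as
      many elements as there are positions.\<close>
    moreover have "card (partial_prod_set G (ws ! j)) = length (ws ! j)"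
      using sj[OF j] by (simp add: partial_prod_set_def simple_product_one_word_def card_image)
    ultimately show "bij_betw (\<lambda>i. left_partial_prod G (ws ! j) (Suc i)) {..<length (ws ! j)}
        (partial_prod_set G (ws ! j))"
      unfolding bij_betw_def by (auto intro: eq_card_imp_inj_on)
  qed
  define f where "f = b \<circ> inv_into ?I c"
  \<comment> \<open>One further partial product multiplies by the current letter on the left, so
    \<open>b k\<close> is that letter times \<open>c k\<close>, and the quotient recovers the
    letter.\<close>
  have quot: "b k \<otimes> inv (c k) = ws ! fst k ! snd k" if k: "k \<in> ?I" for k
  proof -
    obtain j i where ji: "k = (j, i)" "j < length ws" "i < length (ws ! j)" using k by auto
    have "set (ws ! j) \<subseteq> carrier G" using sj[OF ji(2)] by (simp add: simple_product_one_word_def)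
    then have g: "ws ! j ! i \<in> carrier G" and p: "left_partial_prod G (ws ! j) i \<in> carrier G"
      using ji(3) by (auto intro: left_partial_prod_closed)
    have cG: "c k \<in> carrier G" using g p x ji by (simp add: c_def)
    have "b k = ws ! j ! i \<otimes> c k" using g p x ji by (simp add: b_def c_def m_assoc)
    then show ?thesis using g cG ji by (simp add: m_assoc)
  qed
  \<comment> \<open>Writing the multisets as sums of singletons allows reindexing along
    \<open>c\<close> and then splitting the sum over pairs into a sum over words.\<close>
  have "image_mset (\<lambda>g. f g \<otimes> inv g) (mset_set (carrier G)) = (\<Sum>g\<in>carrier G. {#f g \<otimes> inv g#})"
    using fin by (rule image_mset_mset_set_eq_sum)
  also have "\<dots> = (\<Sum>k\<in>?I. {#f (c k) \<otimes> inv (c k)#})"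
    by (rule sum.reindex_bij_betw[OF c, symmetric])
  also have "\<dots> = (\<Sum>k\<in>?I. {#ws ! fst k ! snd k#})"
  proof (rule sum.cong[OF refl])
    fix k assume k: "k \<in> ?I"
    then have "f (c k) = b k" using c by (simp add: f_def bij_betw_inv_into_left)
    then show "{#f (c k) \<otimes> inv (c k)#} = {#ws ! fst k ! snd k#}" using quot[OF k] by simp
  qed
  also have "\<dots> = (\<Sum>j<length ws. \<Sum>i<length (ws ! j). {#ws ! j ! i#})"
    by (subst sum.Sigma) (auto simp: case_prod_beta)
  also have "\<dots> = A" by (simp add: A mset_eq_sum_nth)
  finally have "A = image_mset (\<lambda>g. f g \<otimes> inv g) (mset_set (carrier G))" by simp
  moreover have "bij_betw f (carrier G) (carrier G)"
    unfolding f_def using b c by (blast intro: bij_betw_trans bij_betw_inv_into)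
  ultimately show thesis using that by blast
qed

end

theorem theorem3p4:
  fixes G :: "('a, 'm) monoid_scheme" (structure)
    and A :: "'a multiset"
  assumes "group G"
    and "finite (carrier G)"
    and "size A = order G"
    and "set_mset A \<subseteq> carrier G"
  shows "quotient_realizable G A \<longleftrightarrow> (\<exists>ws. cycle_tiling_decomposition G A ws)"
proof -
  interpret group G by fact
  show ?thesis
    unfolding quotient_realizable_iff_perm[OF assms(2-4)]
  proof
    assume "\<exists>f. bij_betw f (carrier G) (carrier G) \<and>
      A = image_mset (\<lambda>g. f g \<otimes> inv g) (mset_set (carrier G))"
    then obtain f where "inj_on f (carrier G)" "f ` carrier G = carrier G"
      and A: "A = image_mset (\<lambda>g. f g \<otimes> inv g) (mset_set (carrier G))"
      by (auto simp: bij_betw_def)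
    \<comment> \<open>The whole carrier is taken as the set permuted by \<open>f\<close>.\<close>
    with cycles_tile[OF assms(2) order_refl, of f]
    show "\<exists>ws. cycle_tiling_decomposition G A ws"
      unfolding cycle_tiling_decomposition_def A by simp
  next
    assume "\<exists>ws. cycle_tiling_decomposition G A ws"
    then show "\<exists>f. bij_betw f (carrier G) (carrier G) \<and>
      A = image_mset (\<lambda>g. f g \<otimes> inv g) (mset_set (carrier G))"
      using cycle_tiling_imp_perm[OF assms(2)] by metis
  qed
qed

end
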